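(* Let $K$ be a space equipped with a measure $\mu$ and a metric $d$ (not necessarily an effective resistance metric), and let $\mathcal{E}$ be an energy form on $K$. Assume that there exist positive constants $C_1$ and $\gamma$ such that the following Poincaré inequality holds for all locally square integrable functions $u\in\mathcal{D}om(\mathcal{E})$, all $y\in K$ and all $r>0$: $$\int_{B_r(y)}\bigl(u(x)-\bar{u}_{B_r(y)}\bigr)^2\,d\mu(x)\leq C_1 r^{\gamma}\,\mathcal{E}(u,u),$$ where $\bar{u}_{B_r(y)}$ is the average of $u$ over $B_r(y)$. Furthermore, assume that $\mu$ satisfies the reverse volume doubling property: there exist an integer $k$ and a constant $C_2>1$ such that for all $x\in K$ and all $r>0$ $$C_2\,\mu(B_r(x))\leq \mu(B_{kr}(x)).$$ Then there exists a constant $C>0$ such that for all $u\in\mathcal{D}om(\mathcal{E})$ with $\|u\|_2=1$ one has $$Var_\gamma(u)\,\mathcal{E}(u,u)\geq C.$$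
   Context: $(K,d)$ is a metric space equipped with a Borel measure $\mu$. The energy form $\mathcal{E}$ is an arbitrary positive-definite symmetric quadratic form with domain $\mathcal{D}om(\mathcal{E})\subset L^2(K,\mu)$ (no further property, such as being a Dirichlet form, is required). $B_r(x)$ denotes the ball with center $x$ and radius $r$ in the metric $d$, and $\bar{u}_{B}=\frac{1}{\mu(B)}\int_B u\,d\mu$. The norm $\|\cdot\|_2$ is the norm of $L^2(K,\mu)$. The spatial variance is $$Var_\gamma(u)=\iint_{K\times K}d(x,y)^\gamma |u(x)|^2|u(y)|^2\,d\mu(x)\,d\mu(y).$$ The constant $C$ does not depend on $u$. *)

theory Defs
  imports "HOL-Analysis.Analysis"
begin

definition square_integrable :: "'a measure \<Rightarrow> ('a \<Rightarrow> real) \<Rightarrow> bool" where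
  "square_integrable \<mu> u \<longleftrightarrow> u \<in> borel_measurable \<mu> \<and> integrable \<mu> (\<lambda>x. (u x)\<^sup>2)"

definition L2_norm :: "'a measure \<Rightarrow> ('a \<Rightarrow> real) \<Rightarrow> real" where
  "L2_norm \<mu> u = sqrt (LINT x|\<mu>. (u x)\<^sup>2)"

definition locally_square_integrable :: "'a::metric_space measure \<Rightarrow> ('a \<Rightarrow> real) \<Rightarrow> bool" where
  "locally_square_integrable \<mu> u \<longleftrightarrow>
     u \<in> borel_measurable \<mu> \<and> (\<forall>x. \<exists>r>0. set_integrable \<mu> (ball x r) (\<lambda>z. (u z)\<^sup>2))"

(* The domain is a linear subspace of L^2, represented by the functions in its classes:
   D is closed under almost-everywhere modification, and E does not see such modifications.
   Accordingly, definiteness refers to u being nonzero as an element of L^2. *)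
locale energy_form =
  fixes \<mu> :: "'a measure"
    and D :: "('a \<Rightarrow> real) set"
    and E :: "('a \<Rightarrow> real) \<Rightarrow> ('a \<Rightarrow> real) \<Rightarrow> real"
  assumes dom_L2: "u \<in> D \<Longrightarrow> square_integrable \<mu> u"
    and dom_zero: "(\<lambda>x. 0) \<in> D"
    and dom_add: "u \<in> D \<Longrightarrow> v \<in> D \<Longrightarrow> (\<lambda>x. u x + v x) \<in> D"
    and dom_scale: "u \<in> D \<Longrightarrow> (\<lambda>x. c * u x) \<in> D"
    and dom_AE: "u \<in> D \<Longrightarrow> v \<in> borel_measurable \<mu> \<Longrightarrow> AE x in \<mu>. u x = v x \<Longrightarrow> v \<in> D"
    and form_AE: "u \<in> D \<Longrightarrow> v \<in> D \<Longrightarrow> w \<in> D \<Longrightarrow> AE x in \<mu>. u x = v x \<Longrightarrow> E u w = E v w"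
    and form_sym: "u \<in> D \<Longrightarrow> v \<in> D \<Longrightarrow> E u v = E v u"
    and form_add: "u \<in> D \<Longrightarrow> v \<in> D \<Longrightarrow> w \<in> D \<Longrightarrow> E (\<lambda>x. u x + v x) w = E u w + E v w"
    and form_scale: "u \<in> D \<Longrightarrow> w \<in> D \<Longrightarrow> E (\<lambda>x. c * u x) w = c * E u w"
    and form_pos: "u \<in> D \<Longrightarrow> \<not> (AE x in \<mu>. u x = 0) \<Longrightarrow> E u u > 0"

(* Only meaningful for 0 < emeasure \<mu> B < \<infinity>. Otherwise measure \<mu> B = 0, so the average is 0. *)
definition average :: "'a measure \<Rightarrow> 'a set \<Rightarrow> ('a \<Rightarrow> real) \<Rightarrow> real" where
  "average \<mu> B u = (LINT x:B|\<mu>. u x) / measure \<mu> B"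

definition poincare_inequality ::
  "'a::metric_space measure \<Rightarrow> ('a \<Rightarrow> real) set \<Rightarrow> (('a \<Rightarrow> real) \<Rightarrow> ('a \<Rightarrow> real) \<Rightarrow> real)
    \<Rightarrow> real \<Rightarrow> real \<Rightarrow> bool" where
  "poincare_inequality \<mu> D E C\<^sub>1 \<gamma> \<longleftrightarrow>
     (\<forall>u\<in>D. locally_square_integrable \<mu> u \<longrightarrow> (\<forall>y. \<forall>r>0.
        (\<integral>\<^sup>+x\<in>ball y r. ennreal ((u x - average \<mu> (ball y r) u)\<^sup>2) \<partial>\<mu>)
          \<le> ennreal (C\<^sub>1 * r powr \<gamma> * E u u)))"

definition reverse_volume_doubling :: "'a::metric_space measure \<Rightarrow> int \<Rightarrow> real \<Rightarrow> bool" where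
  "reverse_volume_doubling \<mu> k C\<^sub>2 \<longleftrightarrow>
     (\<forall>x. \<forall>r>0. ennreal C\<^sub>2 * emeasure \<mu> (ball x r) \<le> emeasure \<mu> (ball x (of_int k * r)))"

(* The variance may be infinite. It is an iterated integral because, for non-separable spaces,
   dist need not be measurable for the product of the Borel sigma-algebras. *)
definition spatial_variance :: "'a::metric_space measure \<Rightarrow> real \<Rightarrow> ('a \<Rightarrow> real) \<Rightarrow> ennreal" where
  "spatial_variance \<mu> \<gamma> u =
     (\<integral>\<^sup>+y. (\<integral>\<^sup>+x. ennreal (dist x y powr \<gamma> * \<bar>u x\<bar>\<^sup>2 * \<bar>u y\<bar>\<^sup>2) \<partial>\<mu>) \<partial>\<mu>)"

end

theory Submission
  imports Defs
begin

text \<open>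
  Let \<open>V > 0\<close> be an upper bound for the variance of \<open>u\<close>. Averaging the inner integral against \<open>u\<^sup>2\<close> yields a centre \<open>y\<close>
  about which the \<open>\<gamma>\<close>-th moment of \<open>u\<^sup>2\<close> is at most \<open>2 V\<close>, so by Chebyshev the ball \<open>A\<close> of radius
  \<open>r = (4 V)\<^sup>1\<^sup>/\<^sup>\<gamma>\<close> about \<open>y\<close> carries at least half of the \<open>L\<^sup>2\<close> mass. By reverse volume doubling a
  ball \<open>B\<close> of radius \<open>L r\<close> has at least \<open>16\<close> times the measure of \<open>A\<close>. A constant close to \<open>u\<close> on
  \<open>A\<close> would have too large an \<open>L\<^sup>2\<close> norm on \<open>B\<close>, hence \<open>u\<close> is far in \<open>L\<^sup>2(B)\<close> from every
  constant, in particular from its average, and the Poincare inequality on \<open>B\<close> bounds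
  \<open>r\<^sup>\<gamma> E(u,u)\<close> from below.
\<close>

text \<open>The integer \<open>k\<close> may be nonpositive; passing to \<open>max 1 k\<close> keeps
  every intermediate radius positive, so the doubling can be iterated, and it only enlarges the
  balls.\<close>

lemma reverse_volume_doubling_power:
  assumes rvd: "reverse_volume_doubling \<mu> k C" and "C \<ge> 1"
    and "sets \<mu> = sets borel" and "r > 0"
  shows "ennreal (C ^ n) * emeasure \<mu> (ball x r) \<le> emeasure \<mu> (ball x (real_of_int (max 1 k) ^ n * r))"
proof (induction n)
  case (Suc n)
  define R where "R = real_of_int (max 1 k) ^ n * r"
  have R: "R > 0" unfolding R_def using \<open>r > 0\<close> by simp
  have "ennreal (C ^ Suc n) * emeasure \<mu> (ball x r)
      = ennreal C * (ennreal (C ^ n) * emeasure \<mu> (ball x r))"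
    using \<open>C \<ge> 1\<close> by (simp add: ennreal_mult mult.assoc)
  also have "\<dots> \<le> ennreal C * emeasure \<mu> (ball x R)"
    using Suc.IH by (intro mult_left_mono) (auto simp: R_def)
  also have "\<dots> \<le> emeasure \<mu> (ball x (of_int k * R))"
    using rvd R by (simp add: reverse_volume_doubling_def)
  also have "\<dots> \<le> emeasure \<mu> (ball x (real_of_int (max 1 k) * R))"
    using R assms(3) by (intro emeasure_mono subset_ball mult_right_mono) auto
  finally show ?case by (simp add: R_def mult.assoc)
qed simp

text \<open>If the deviation is small, the mass on \<open>A\<close> bounds \<open>a\<^sup>2\<close>
  times the measure of \<open>A\<close> from below, while total mass 1 bounds
  \<open>a\<^sup>2\<close> times the measure of \<open>B\<close> from above; the volume factor makes
  the two incompatible. Extended reals also cover sets of infinite measure.\<close>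

lemma deviation_from_constant_ge:
  fixes u :: "'a \<Rightarrow> real"
  assumes u[measurable]: "u \<in> borel_measurable \<mu>"
    and [measurable]: "A \<in> sets \<mu>" "B \<in> sets \<mu>" and "A \<subseteq> B"
    and vol: "16 * emeasure \<mu> A \<le> emeasure \<mu> B"
    and total: "(\<integral>\<^sup>+x. ennreal ((u x)\<^sup>2) \<partial>\<mu>) = 1"
    and conc: "ennreal (1/2) \<le> (\<integral>\<^sup>+x\<in>A. ennreal ((u x)\<^sup>2) \<partial>\<mu>)"
    and dev: "(\<integral>\<^sup>+x\<in>B. ennreal ((u x - a)\<^sup>2) \<partial>\<mu>) \<le> ennreal q"
    and "q \<ge> 0"
  shows "1/9 \<le> q"
proof -
  define P where "P = (\<integral>\<^sup>+x\<in>B. ennreal ((u x - a)\<^sup>2) \<partial>\<mu>)"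
  have "ennreal (1/2) \<le> (\<integral>\<^sup>+x\<in>A. ennreal ((u x)\<^sup>2) \<partial>\<mu>)" by fact
  also have "\<dots> \<le> (\<integral>\<^sup>+x. 2 * (ennreal ((u x - a)\<^sup>2) * indicator B x)
      + ennreal (2 * a\<^sup>2) * indicator A x \<partial>\<mu>)"
  proof (intro nn_integral_mono)
    fix x
    have "(u x)\<^sup>2 \<le> 2 * (u x - a)\<^sup>2 + 2 * a\<^sup>2"
      using zero_le_power2[of "u x - 2 * a"] by (simp add: power2_eq_square algebra_simps)
    hence "ennreal ((u x)\<^sup>2) \<le> ennreal (2 * (u x - a)\<^sup>2 + 2 * a\<^sup>2)"
      by (rule ennreal_leI)
    also have "\<dots> = 2 * ennreal ((u x - a)\<^sup>2) + ennreal (2 * a\<^sup>2)"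
      by (simp add: ennreal_mult)
    finally show "ennreal ((u x)\<^sup>2) * indicator A x
        \<le> 2 * (ennreal ((u x - a)\<^sup>2) * indicator B x) + ennreal (2 * a\<^sup>2) * indicator A x"
      using \<open>A \<subseteq> B\<close> by (auto simp: indicator_def)
  qed
  also have "\<dots> = 2 * P + ennreal (2 * a\<^sup>2) * emeasure \<mu> A"
    by (subst nn_integral_add) (auto simp: nn_integral_cmult nn_integral_cmult_indicator P_def)
  finally have 1: "ennreal (1/2) \<le> 2 * P + ennreal (2 * a\<^sup>2) * emeasure \<mu> A" .

  have "ennreal (2 * a\<^sup>2) * emeasure \<mu> B = (\<integral>\<^sup>+x. ennreal (2 * a\<^sup>2) * indicator B x \<partial>\<mu>)"
    by (simp add: nn_integral_cmult_indicator)
  also have "\<dots> \<le> (\<integral>\<^sup>+x. 4 * (ennreal ((u x - a)\<^sup>2) * indicator B x) + 4 * ennreal ((u x)\<^sup>2) \<partial>\<mu>)"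
  proof (intro nn_integral_mono)
    fix x
    have "2 * a\<^sup>2 \<le> 4 * (u x - a)\<^sup>2 + 4 * (u x)\<^sup>2"
      using zero_le_power2[of "2 * u x - a"] by (simp add: power2_eq_square algebra_simps)
    hence "ennreal (2 * a\<^sup>2) \<le> ennreal (4 * (u x - a)\<^sup>2 + 4 * (u x)\<^sup>2)"
      by (rule ennreal_leI)
    also have "\<dots> = 4 * ennreal ((u x - a)\<^sup>2) + 4 * ennreal ((u x)\<^sup>2)"
      by (simp add: ennreal_mult)
    finally show "ennreal (2 * a\<^sup>2) * indicator B x
        \<le> 4 * (ennreal ((u x - a)\<^sup>2) * indicator B x) + 4 * ennreal ((u x)\<^sup>2)"
      by (auto simp: indicator_def)
  qed
  also have "\<dots> = 4 * P + 4"
    by (subst nn_integral_add) (auto simp: nn_integral_cmult P_def total)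
  finally have 2: "ennreal (2 * a\<^sup>2) * emeasure \<mu> B \<le> 4 * P + 4" .

  \<comment> \<open>Scaling the first estimate by 16 turns its volume term into one controlled by
    the second. The factor is large enough that the resulting 8 exceeds the 4 left over from the
    total mass.\<close>
  have "ennreal 8 = 16 * ennreal (1/2)"
    by (subst ennreal_numeral[symmetric], subst ennreal_mult[symmetric]) auto
  also have "\<dots> \<le> 16 * (2 * P + ennreal (2 * a\<^sup>2) * emeasure \<mu> A)"
    by (intro mult_left_mono 1) auto
  also have "\<dots> = 32 * P + ennreal (2 * a\<^sup>2) * (16 * emeasure \<mu> A)"
    by (simp add: algebra_simps)
  also have "\<dots> \<le> 32 * P + ennreal (2 * a\<^sup>2) * emeasure \<mu> B"
    by (intro add_left_mono mult_left_mono vol) auto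
  also have "\<dots> \<le> 32 * P + (4 * P + 4)"
    by (intro add_left_mono 2)
  also have "\<dots> = 36 * P + 4"
    by (simp add: add.assoc[symmetric] flip: distrib_right)
  also have "\<dots> \<le> 36 * ennreal q + 4"
    using dev unfolding P_def by (intro add_mono mult_left_mono) auto
  also have "\<dots> = ennreal (36 * q + 4)"
    using \<open>q \<ge> 0\<close> by (simp add: ennreal_mult)
  finally have "8 \<le> 36 * q + 4"
    using \<open>q \<ge> 0\<close> by (subst (asm) ennreal_le_iff) auto
  thus ?thesis by simp
qed

lemma variance_concentration:
  fixes u :: "'a::metric_space \<Rightarrow> real"
  assumes sets: "sets \<mu> = sets borel" and u[measurable]: "u \<in> borel_measurable \<mu>"
    and total: "(\<integral>\<^sup>+x. ennreal ((u x)\<^sup>2) \<partial>\<mu>) = 1"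
    and var: "spatial_variance \<mu> \<gamma> u \<le> ennreal s"
    and "s > 0" "r > 0" "\<gamma> > 0" and r: "r powr \<gamma> = 4 * s"
  obtains y where "ennreal (1/2) \<le> (\<integral>\<^sup>+x\<in>ball y r. ennreal ((u x)\<^sup>2) \<partial>\<mu>)"
proof -
  define F where "F y = (\<integral>\<^sup>+x. ennreal (dist x y powr \<gamma> * (u x)\<^sup>2) \<partial>\<mu>)" for y
  have dist_meas[measurable]: "(\<lambda>x. dist x y) \<in> borel_measurable \<mu>" for y
    by (subst measurable_cong_sets[OF sets refl])
      (intro borel_measurable_continuous_onI continuous_intros)
  have ball_meas[measurable]: "ball y r \<in> sets \<mu>" for y
    by (simp add: sets)
  have inner: "(\<integral>\<^sup>+x. ennreal (dist x y powr \<gamma> * \<bar>u x\<bar>\<^sup>2 * \<bar>u y\<bar>\<^sup>2) \<partial>\<mu>) = F y * ennreal ((u y)\<^sup>2)" for y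
    unfolding F_def by (subst nn_integral_multc[symmetric]) (auto simp: ennreal_mult)
  \<comment> \<open>The factor 2 leaves room for a contradiction from non-strict bounds. Only
    monotonicity of the integral is used, so measurability of \<open>F\<close> is not at
    issue.\<close>
  have "\<exists>y. F y \<le> ennreal (2 * s)"
  proof (rule ccontr)
    assume "\<not> ?thesis"
    hence F: "ennreal (2 * s) \<le> F y" for y by (meson linear)
    have "ennreal (2 * s) = (\<integral>\<^sup>+y. ennreal (2 * s) * ennreal ((u y)\<^sup>2) \<partial>\<mu>)"
      by (simp add: nn_integral_cmult total)
    also have "\<dots> \<le> spatial_variance \<mu> \<gamma> u"
      unfolding spatial_variance_def inner by (intro nn_integral_mono mult_right_mono F) auto
    also note var
    finally show False using \<open>s > 0\<close> by simp
  qed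
  then obtain y where y: "F y \<le> ennreal (2 * s)" ..
  \<comment> \<open>Chebyshev: off the ball, \<open>dist x y powr \<gamma>\<close> is at least
    \<open>4 * s\<close>, so the mass there is at most \<open>2 * s / (4 * s)\<close>, one
    half.\<close>
  have "ennreal (1/2) + ennreal (1/2) = (\<integral>\<^sup>+x. ennreal ((u x)\<^sup>2) \<partial>\<mu>)"
    unfolding total by (subst ennreal_plus[symmetric]) auto
  also have "\<dots> \<le> (\<integral>\<^sup>+x. ennreal ((u x)\<^sup>2) * indicator (ball y r) x
      + ennreal (1 / (4 * s)) * ennreal (dist x y powr \<gamma> * (u x)\<^sup>2) \<partial>\<mu>)"
  proof (intro nn_integral_mono)
    fix x
    show "ennreal ((u x)\<^sup>2) \<le> ennreal ((u x)\<^sup>2) * indicator (ball y r) x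
      + ennreal (1 / (4 * s)) * ennreal (dist x y powr \<gamma> * (u x)\<^sup>2)"
    proof (cases "x \<in> ball y r")
      case False
      hence "4 * s \<le> dist x y powr \<gamma>"
        unfolding r[symmetric] using \<open>r > 0\<close> \<open>\<gamma> > 0\<close>
        by (intro powr_mono2) (auto simp: dist_commute)
      hence "4 * s * (u x)\<^sup>2 \<le> dist x y powr \<gamma> * (u x)\<^sup>2"
        by (intro mult_right_mono) auto
      hence "(u x)\<^sup>2 \<le> 1 / (4 * s) * (dist x y powr \<gamma> * (u x)\<^sup>2)"
        using \<open>s > 0\<close> by (simp add: field_simps)
      thus ?thesis using False \<open>s > 0\<close> by (simp add: ennreal_leI flip: ennreal_mult)
    qed simp
  qed
  also have "\<dots> = (\<integral>\<^sup>+x\<in>ball y r. ennreal ((u x)\<^sup>2) \<partial>\<mu>) + ennreal (1 / (4 * s)) * F y"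
    unfolding F_def by (subst nn_integral_add) (auto simp: nn_integral_cmult)
  also have "\<dots> \<le> (\<integral>\<^sup>+x\<in>ball y r. ennreal ((u x)\<^sup>2) \<partial>\<mu>) + ennreal (1 / (4 * s)) * ennreal (2 * s)"
    by (intro add_left_mono mult_left_mono y) auto
  also have "ennreal (1 / (4 * s)) * ennreal (2 * s) = ennreal (1/2)"
    using \<open>s > 0\<close> by (subst ennreal_mult[symmetric]) auto
  finally have "ennreal (1/2) \<le> (\<integral>\<^sup>+x\<in>ball y r. ennreal ((u x)\<^sup>2) \<partial>\<mu>)"
    by (simp add: add.commute[of _ "ennreal (1/2)"] ennreal_add_left_cancel_le)
  thus ?thesis by (rule that)
qed

theorem theorem4:
  fixes \<mu> :: "'a::metric_space measure"
    and D :: "('a \<Rightarrow> real) set"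
    and E :: "('a \<Rightarrow> real) \<Rightarrow> ('a \<Rightarrow> real) \<Rightarrow> real"
    and \<gamma> :: real
  assumes "sets \<mu> = sets borel"
    and "energy_form \<mu> D E"
    and "\<gamma> > 0"
    and "\<exists>C\<^sub>1>0. poincare_inequality \<mu> D E C\<^sub>1 \<gamma>"
    and "\<exists>k. \<exists>C\<^sub>2>1. reverse_volume_doubling \<mu> k C\<^sub>2"
  shows "\<exists>C>0. \<forall>u\<in>D. L2_norm \<mu> u = 1 \<longrightarrow>
    spatial_variance \<mu> \<gamma> u * ennreal (E u u) \<ge> ennreal C"
proof -
  obtain C\<^sub>1 where C1: "C\<^sub>1 > 0" and poin: "poincare_inequality \<mu> D E C\<^sub>1 \<gamma>"
    using assms(4) by blast
  obtain k C\<^sub>2 where C2: "C\<^sub>2 > 1" and rvd: "reverse_volume_doubling \<mu> k C\<^sub>2"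
    using assms(5) by blast
  obtain n where n: "16 < C\<^sub>2 ^ n" using real_arch_pow[OF C2] by blast
  define L where "L = real_of_int (max 1 k) ^ n"
  have L: "L \<ge> 1" unfolding L_def by (intro one_le_power) auto
  have vol: "16 * emeasure \<mu> (ball x r) \<le> emeasure \<mu> (ball x (L * r))" if "r > 0" for x r
  proof -
    have "16 * emeasure \<mu> (ball x r) \<le> ennreal (C\<^sub>2 ^ n) * emeasure \<mu> (ball x r)"
      using n ennreal_leI[of 16 "C\<^sub>2 ^ n"] by (intro mult_right_mono) auto
    also have "\<dots> \<le> emeasure \<mu> (ball x (L * r))"
      unfolding L_def
      using reverse_volume_doubling_power[OF rvd _ assms(1) that] C2 by simp
    finally show ?thesis .
  qed
  \<comment> \<open>Obtained by solving
    \<open>1/9 \<le> C\<^sub>1 * (L powr \<gamma> * (4 * s)) * E u u\<close> for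
    \<open>s * E u u\<close>.\<close>
  define C where "C = 1 / (36 * C\<^sub>1 * L powr \<gamma>)"
  have C: "C > 0" using C1 L by (simp add: C_def)
  have "ennreal C \<le> spatial_variance \<mu> \<gamma> u * ennreal (E u u)"
    if u: "u \<in> D" and norm: "L2_norm \<mu> u = 1" for u
  proof -
    have "square_integrable \<mu> u"
      using energy_form.dom_L2[OF assms(2) u] .
    hence um[measurable]: "u \<in> borel_measurable \<mu>" and ui: "integrable \<mu> (\<lambda>x. (u x)\<^sup>2)"
      by (auto simp: square_integrable_def)
    have int1: "(LINT x|\<mu>. (u x)\<^sup>2) = 1"
      using norm by (simp add: L2_norm_def)
    have total: "(\<integral>\<^sup>+x. ennreal ((u x)\<^sup>2) \<partial>\<mu>) = 1"
      using nn_integral_eq_integral[OF ui] int1 by simp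
    have loc: "locally_square_integrable \<mu> u"
      unfolding locally_square_integrable_def set_integrable_def
    proof (intro conjI allI exI[of _ 1])
      show "integrable \<mu> (\<lambda>z. indicat_real (ball x 1) z *\<^sub>R (u z)\<^sup>2)" for x
        by (rule integrable_mult_indicator[OF _ ui]) (simp add: assms(1))
    qed (use um in auto)
    have "\<not> (AE x in \<mu>. u x = 0)"
    proof
      assume "AE x in \<mu>. u x = 0"
      hence "(LINT x|\<mu>. (u x)\<^sup>2) = (LINT x|\<mu>. 0)" by (intro integral_cong_AE) auto
      thus False using int1 by simp
    qed
    hence Epos: "E u u > 0"
      using energy_form.form_pos[OF assms(2) u] by blast
    \<comment> \<open>Any positive upper bound \<open>s\<close> is allowed because the variance
      itself might be zero, which would give radius zero.\<close>
    have key: "C \<le> s * E u u" if s: "s > 0" and V: "spatial_variance \<mu> \<gamma> u \<le> ennreal s" for s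
    proof -
      define r where "r = (4 * s) powr (1 / \<gamma>)"
      have r: "r > 0" "r powr \<gamma> = 4 * s"
        using s \<open>\<gamma> > 0\<close> by (auto simp: r_def powr_powr)
      obtain y where y: "ennreal (1/2) \<le> (\<integral>\<^sup>+x\<in>ball y r. ennreal ((u x)\<^sup>2) \<partial>\<mu>)"
        using variance_concentration[OF assms(1) um total V s r(1) \<open>\<gamma> > 0\<close> r(2)] .
      have Lr: "L * r > 0" "r \<le> L * r" using L r(1) by auto
      \<comment> \<open>The deviation bound holds for every constant, hence also for the default
        value 0 of \<open>average\<close> on a ball of infinite measure.\<close>
      have "1/9 \<le> C\<^sub>1 * (L * r) powr \<gamma> * E u u"
      proof (rule deviation_from_constant_ge[OF um _ _ _ vol[OF r(1)] total y])
        show "(\<integral>\<^sup>+x\<in>ball y (L * r). ennreal ((u x - average \<mu> (ball y (L * r)) u)\<^sup>2) \<partial>\<mu>)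
          \<le> ennreal (C\<^sub>1 * (L * r) powr \<gamma> * E u u)"
          using poin u loc Lr(1) by (simp add: poincare_inequality_def)
      qed (use Lr C1 Epos assms(1) in \<open>auto intro: subset_ball\<close>)
      also have "(L * r) powr \<gamma> = L powr \<gamma> * (4 * s)"
        using L r by (simp add: powr_mult)
      finally have "1/9 \<le> C\<^sub>1 * (L powr \<gamma> * (4 * s)) * E u u" .
      thus ?thesis using C1 L by (simp add: C_def field_simps)
    qed
    show ?thesis
    proof (cases "spatial_variance \<mu> \<gamma> u" rule: ennreal_cases)
      case (real v)
      have "C \<le> v * E u u"
      proof (cases "v = 0")
        case True
        \<comment> \<open>Zero variance is impossible: this choice of \<open>s\<close> would yield
          \<open>C \<le> C / 2\<close>.\<close>
        thus ?thesis using key[of "C / (2 * E u u)"] real C Epos by auto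
      qed (use key[of v] real in auto)
      thus ?thesis using real Epos by (simp add: ennreal_leI flip: ennreal_mult)
    next
      case top
      thus ?thesis using Epos by (simp add: ennreal_top_mult)
    qed
  qed
  thus ?thesis using C by blast
qed

end
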